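(* Let $V$ be a countable set with at least two elements. Let $(K_t)_{t\ge1}$ be a sequence of Markov transition operators on $V$ and $(\pi_t)_{t\ge1}$ a sequence of finite positive measures on $V$ such that $\{(K_t,\pi_t)\}_{t\ge1}$ is a finite non-decreasing environment. Let $\lambda_t=\lambda(Q_t,\pi_t)$ be the second highest eigenvalue of $Q_t=K_t^*K_t$, where $K_t^*$ is the adjoint of $K_t$ on $\ell^2(\pi_t)$. Then $$\forall t\ge0,\ \forall f\in\ell^2(\pi_t),\quad \operatorname{Var}_{\tilde\pi_1}(K_{0,t}f)\le\frac{\pi_t(V)}{\pi_1(V)}\operatorname{Var}_{\tilde\pi_t}(f)\prod_{s=1}^t\lambda_s,$$ and the operator $f\mapsto K_{0,t}f-\tilde\pi_1(K_{0,t}f)$ satisfies $$\left\|K_{0,t}-\tilde\pi_1(K_{0,t}\,\cdot)\right\|_{\ell^2(\tilde\pi_t)\to\ell^2(\tilde\pi_1)}\le\sqrt{\frac{\pi_t(V)}{\pi_1(V)}\prod_{s=1}^t\lambda_s}.$$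
   Context: A Markov transition operator $K$ on $V$ is a map $K:V\times V\to[0,1]$ with $\sum_y K(x,y)=1$ for all $x$; it acts on functions by $(Kf)(x)=\sum_y K(x,y)f(y)$ and on measures by $(\mu K)(y)=\sum_x\mu(x)K(x,y)$. $K_{0,t}=K_1K_2\cdots K_t$, $K_{0,0}=I$, and $\pi_0:=\pi_1$. Finite non-decreasing environment: the $\pi_t$ are positive measures ($\pi_t(x)>0$ for all $x$) with, for all $t\ge1$: $\pi_tK_t=\pi_t$; $\pi_t(V)<+\infty$; $\pi_{t+1}(x)\ge\pi_t(x)$ for all $x\in V$. For a finite measure $\pi$, $\tilde\pi:=\pi/\pi(V)$, and $\tilde\pi(f)=\sum_xf(x)\tilde\pi(x)$, $\operatorname{Var}_{\tilde\pi}(f)=\tilde\pi(f^2)-\tilde\pi(f)^2$. The number $\lambda(Q,\pi)$ (called the second highest eigenvalue of $Q$) is defined variationally by $$1-\lambda(Q,\pi)=\inf\left\{\frac{\mathcal E_{Q,\tilde\pi}(f,f)}{\operatorname{Var}_{\tilde\pi}(f)}\;\Big|\;f\in\ell^2(\tilde\pi),\ f\text{ non-constant}\right\},$$ where $\mathcal E_{Q,\tilde\pi}(f,f)=\langle(I-Q)f,f\rangle_{\tilde\pi}=\frac12\sum_{x,y}(f(x)-f(y))^2Q(x,y)\tilde\pi(x)$. *)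

theory Defs
  imports "HOL-Analysis.Analysis"
begin

text \<open>
  The countable state space is a type. A finite measure is given by its point masses
  \<open>'v \<Rightarrow> real\<close>, an operator by its kernel \<open>'v \<Rightarrow> 'v \<Rightarrow> real\<close>; functions are real-valued.
\<close>

type_synonym 'v kernel = "'v \<Rightarrow> 'v \<Rightarrow> real"

definition markov_operator :: "'v kernel \<Rightarrow> bool" where
  "markov_operator K \<longleftrightarrow>
     (\<forall>x y. 0 \<le> K x y \<and> K x y \<le> 1) \<and> (\<forall>x. (K x has_sum 1) UNIV)"

definition act_fun :: "'v kernel \<Rightarrow> ('v \<Rightarrow> real) \<Rightarrow> 'v \<Rightarrow> real" where
  "act_fun K f x = (\<Sum>\<^sub>\<infinity>y. K x y * f y)"

definition act_meas :: "('v \<Rightarrow> real) \<Rightarrow> 'v kernel \<Rightarrow> 'v \<Rightarrow> real" where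
  "act_meas \<mu> K y = (\<Sum>\<^sub>\<infinity>x. \<mu> x * K x y)"

definition kernel_comp :: "'v kernel \<Rightarrow> 'v kernel \<Rightarrow> 'v kernel" where
  "kernel_comp K L x y = (\<Sum>\<^sub>\<infinity>z. K x z * L z y)"

definition kernel_id :: "'v kernel" where
  "kernel_id x y = (if x = y then 1 else 0)"

text \<open>\<open>iter_kernel K t\<close> is \<open>K 1 \<cdots> K t\<close>; the value \<open>K 0\<close> is never used.\<close>

fun iter_kernel :: "(nat \<Rightarrow> 'v kernel) \<Rightarrow> nat \<Rightarrow> 'v kernel" where
  "iter_kernel K 0 = kernel_id"
| "iter_kernel K (Suc t) = kernel_comp (iter_kernel K t) (K (Suc t))"

definition total_mass :: "('v \<Rightarrow> real) \<Rightarrow> real" where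
  "total_mass \<pi> = (\<Sum>\<^sub>\<infinity>x. \<pi> x)"

definition tilde :: "('v \<Rightarrow> real) \<Rightarrow> 'v \<Rightarrow> real" where
  "tilde \<pi> x = \<pi> x / total_mass \<pi>"

definition mean :: "('v \<Rightarrow> real) \<Rightarrow> ('v \<Rightarrow> real) \<Rightarrow> real" where
  "mean \<mu> f = (\<Sum>\<^sub>\<infinity>x. f x * \<mu> x)"

definition Var :: "('v \<Rightarrow> real) \<Rightarrow> ('v \<Rightarrow> real) \<Rightarrow> real" where
  "Var \<mu> f = mean \<mu> (\<lambda>x. (f x)\<^sup>2) - (mean \<mu> f)\<^sup>2"

definition l2 :: "('v \<Rightarrow> real) \<Rightarrow> ('v \<Rightarrow> real) set" where
  "l2 \<mu> = {f. (\<lambda>x. (f x)\<^sup>2 * \<mu> x) summable_on UNIV}"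

definition l2_inner :: "('v \<Rightarrow> real) \<Rightarrow> ('v \<Rightarrow> real) \<Rightarrow> ('v \<Rightarrow> real) \<Rightarrow> real" where
  "l2_inner \<mu> f g = (\<Sum>\<^sub>\<infinity>x. f x * g x * \<mu> x)"

text \<open>
  The norm takes the value \<open>\<infinity>\<close> outside \<open>l2\<close>, so that an operator of finite norm
  maps \<open>l2 \<mu>\<close> into \<open>l2 \<nu>\<close>.
\<close>

definition l2_norm :: "('v \<Rightarrow> real) \<Rightarrow> ('v \<Rightarrow> real) \<Rightarrow> ennreal" where
  "l2_norm \<mu> f = (if f \<in> l2 \<mu> then ennreal (sqrt (l2_inner \<mu> f f)) else \<infinity>)"

definition l2_op_norm ::
  "('v \<Rightarrow> real) \<Rightarrow> ('v \<Rightarrow> real) \<Rightarrow> (('v \<Rightarrow> real) \<Rightarrow> ('v \<Rightarrow> real)) \<Rightarrow> ennreal" where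
  "l2_op_norm \<mu> \<nu> T = (SUP f\<in>{f. l2_norm \<mu> f \<le> 1}. l2_norm \<nu> (T f))"

definition is_l2_adjoint :: "('v \<Rightarrow> real) \<Rightarrow> 'v kernel \<Rightarrow> 'v kernel \<Rightarrow> bool" where
  "is_l2_adjoint \<pi> K L \<longleftrightarrow>
     (\<forall>g\<in>l2 \<pi>. act_fun L g \<in> l2 \<pi>) \<and>
     (\<forall>f\<in>l2 \<pi>. \<forall>g\<in>l2 \<pi>. l2_inner \<pi> (act_fun K f) g = l2_inner \<pi> f (act_fun L g))"

text \<open>
  If \<open>\<pi>\<close> is positive, testing against point indicators shows that at most one kernel is
  adjoint to \<open>K\<close>, namely \<open>L x y = \<pi> y * K y x / \<pi> x\<close>; this kernel is adjoint to \<open>K\<close>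
  when \<open>K\<close> is Markov and \<open>\<pi>\<close> is \<open>K\<close>-invariant.
\<close>

definition l2_adjoint :: "('v \<Rightarrow> real) \<Rightarrow> 'v kernel \<Rightarrow> 'v kernel" where
  "l2_adjoint \<pi> K = (THE L. is_l2_adjoint \<pi> K L)"

definition dirichlet_form :: "'v kernel \<Rightarrow> ('v \<Rightarrow> real) \<Rightarrow> ('v \<Rightarrow> real) \<Rightarrow> real" where
  "dirichlet_form Q \<mu> f = l2_inner \<mu> (\<lambda>x. f x - act_fun Q f x) f"

definition second_eigenvalue :: "'v kernel \<Rightarrow> ('v \<Rightarrow> real) \<Rightarrow> real" where
  "second_eigenvalue Q \<pi> =
     1 - Inf {dirichlet_form Q (tilde \<pi>) f / Var (tilde \<pi>) f | f.
                f \<in> l2 (tilde \<pi>) \<and> \<not> f constant_on UNIV}"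

definition finite_nondecreasing_env ::
  "(nat \<Rightarrow> 'v kernel) \<Rightarrow> (nat \<Rightarrow> 'v \<Rightarrow> real) \<Rightarrow> bool" where
  "finite_nondecreasing_env K \<pi> \<longleftrightarrow>
     (\<forall>t\<ge>1. markov_operator (K t) \<and>
            (\<forall>x. \<pi> t x > 0) \<and>
            act_meas (\<pi> t) (K t) = \<pi> t \<and>
            \<pi> t summable_on UNIV \<and>
            (\<forall>x. \<pi> (Suc t) x \<ge> \<pi> t x))"

end

theory Submission
  imports Defs
begin

text \<open>
  If \<open>K\<close> preserves the probability \<open>\<mu>\<close> and \<open>Q = K\<^sup>* K\<close>, the Dirichlet form of \<open>Q\<close> at \<open>f\<close> is
  \<open>\<parallel>f\<parallel>\<^sup>2 - \<parallel>K f\<parallel>\<^sup>2 = Var f - Var (K f)\<close>, so the variational definition of the second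
  eigenvalue \<open>\<lambda>\<close> gives \<open>Var (K f) \<le> \<lambda> Var f\<close>. Since \<open>\<pi>(V) Var f\<close> is the minimum over
  \<open>c\<close> of \<open>\<Sum>\<^sub>x (f x - c)\<^sup>2 \<pi> x\<close>, it is monotone in \<open>\<pi>\<close>; alternating the two
  inequalities along \<open>K\<^sub>1 \<cdots> K\<^sub>t\<close> gives the theorem.
\<close>

lemma summable_on_dominated:
  fixes f g :: "'a \<Rightarrow> real"
  assumes "g summable_on A" "\<And>x. x \<in> A \<Longrightarrow> \<bar>f x\<bar> \<le> g x"
  shows "f summable_on A"
proof -
  have "(\<lambda>x. \<bar>f x\<bar>) summable_on A"
    by (rule summable_on_comparison_test[OF assms(1)]) (use assms(2) in auto)
  then show ?thesis
    using summable_on_iff_abs_summable_on_real[of f A] by simp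
qed

lemma summable_on_real_abs:
  fixes f :: "'a \<Rightarrow> real"
  shows "f summable_on A \<Longrightarrow> (\<lambda>x. \<bar>f x\<bar>) summable_on A"
  using summable_on_iff_abs_summable_on_real[of f A] by simp

lemma abs_mult_le_sum_squares:
  fixes a b :: real
  shows "\<bar>a * b\<bar> \<le> a\<^sup>2 + b\<^sup>2"
proof -
  have "2 * (\<bar>a\<bar> * \<bar>b\<bar>) \<le> \<bar>a\<bar>\<^sup>2 + \<bar>b\<bar>\<^sup>2"
    using sum_squares_bound[of "\<bar>a\<bar>" "\<bar>b\<bar>"] by (simp add: mult.assoc)
  moreover have "0 \<le> \<bar>a\<bar> * \<bar>b\<bar>" by simp
  ultimately show ?thesis unfolding abs_mult power2_abs by linarith
qed

lemma act_fun_kernel_id: "act_fun kernel_id f = f"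
proof
  fix x
  have "((\<lambda>y. kernel_id x y * f y) has_sum f x) UNIV"
    by (rule has_sum_finite_neutralI[where B = "{x}"]) (auto simp: kernel_id_def)
  then show "act_fun kernel_id f x = f x"
    unfolding act_fun_def by (rule infsumI)
qed

subsection \<open>Variance with respect to a positive finite measure\<close>

locale positive_weight =
  fixes \<mu> :: "'v \<Rightarrow> real"
  assumes pos: "\<mu> x > 0" and summable: "\<mu> summable_on UNIV"
begin

lemma nonneg: "0 \<le> \<mu> x"
  using pos[of x] by simp

lemma total_mass_pos: "0 < total_mass \<mu>"
proof -
  obtain x :: 'v where True by simp
  have "0 < \<mu> x" by (rule pos)
  also have "\<mu> x = sum \<mu> {x}" by simp
  also have "\<dots> \<le> total_mass \<mu>"
    unfolding total_mass_def
    by (rule finite_sum_le_infsum) (use summable nonneg in auto)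
  finally show ?thesis .
qed

lemma tilde_pos: "0 < tilde \<mu> x"
  using pos total_mass_pos by (simp add: tilde_def)

lemma tilde_summable: "tilde \<mu> summable_on UNIV"
  unfolding tilde_def divide_inverse by (rule summable_on_cmult_left[OF summable])

lemma total_mass_tilde: "total_mass (tilde \<mu>) = 1"
proof -
  have "total_mass (tilde \<mu>) = total_mass \<mu> / total_mass \<mu>"
    unfolding total_mass_def[of "tilde \<mu>"] tilde_def divide_inverse infsum_cmult_left'
    by (simp add: total_mass_def)
  then show ?thesis using total_mass_pos by simp
qed

lemma l2_tilde: "l2 (tilde \<mu>) = l2 \<mu>"
proof -
  have "(\<lambda>x. (f x)\<^sup>2 * tilde \<mu> x) summable_on UNIV \<longleftrightarrow> (\<lambda>x. (f x)\<^sup>2 * \<mu> x) summable_on UNIV" for f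
  proof -
    have "(\<lambda>x. (f x)\<^sup>2 * tilde \<mu> x) = (\<lambda>x. ((f x)\<^sup>2 * \<mu> x) * inverse (total_mass \<mu>))"
      by (simp add: tilde_def fun_eq_iff divide_inverse)
    then show ?thesis using total_mass_pos summable_on_cmult_left'[of "inverse (total_mass \<mu>)"]
      by simp
  qed
  then show ?thesis by (simp add: l2_def)
qed

lemma mean_tilde: "total_mass \<mu> * mean (tilde \<mu>) f = mean \<mu> f"
proof -
  have "mean (tilde \<mu>) f = (\<Sum>\<^sub>\<infinity>x. f x * \<mu> x * inverse (total_mass \<mu>))"
    by (simp add: mean_def tilde_def divide_inverse mult.assoc)
  also have "\<dots> = mean \<mu> f * inverse (total_mass \<mu>)"
    unfolding mean_def by (rule infsum_cmult_left')
  finally show ?thesis using total_mass_pos by (simp add: field_simps)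
qed

lemma l2_square_summable: "f \<in> l2 \<mu> \<Longrightarrow> (\<lambda>x. (f x)\<^sup>2 * \<mu> x) summable_on UNIV"
  by (simp add: l2_def)

lemma l2_mult_summable:
  assumes "f \<in> l2 \<mu>" "g \<in> l2 \<mu>"
  shows "(\<lambda>x. f x * g x * \<mu> x) summable_on UNIV"
proof (rule summable_on_dominated)
  show "(\<lambda>x. (f x)\<^sup>2 * \<mu> x + (g x)\<^sup>2 * \<mu> x) summable_on UNIV"
    by (intro summable_on_add l2_square_summable assms)
  show "\<bar>f x * g x * \<mu> x\<bar> \<le> (f x)\<^sup>2 * \<mu> x + (g x)\<^sup>2 * \<mu> x" for x
  proof -
    have "\<bar>f x * g x\<bar> * \<mu> x \<le> ((f x)\<^sup>2 + (g x)\<^sup>2) * \<mu> x"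
      by (rule mult_right_mono[OF abs_mult_le_sum_squares nonneg])
    then show ?thesis using nonneg[of x] by (simp add: abs_mult algebra_simps)
  qed
qed

lemma const_in_l2: "(\<lambda>_. c) \<in> l2 \<mu>"
  unfolding l2_def using summable_on_cmult_right[OF summable] by simp

lemma l2_summable:
  assumes "f \<in> l2 \<mu>" shows "(\<lambda>x. f x * \<mu> x) summable_on UNIV"
  using l2_mult_summable[OF assms const_in_l2[of 1]] by simp

lemma indicator_in_l2: "indicator {y} \<in> l2 \<mu>"
  unfolding l2_def
  by (auto intro!: finite_nonzero_values_imp_summable_on simp: indicator_def)

lemma l2_diff:
  assumes "f \<in> l2 \<mu>" "g \<in> l2 \<mu>" shows "(\<lambda>x. f x - g x) \<in> l2 \<mu>"
proof -
  have "(\<lambda>x. (f x)\<^sup>2 * \<mu> x + (g x)\<^sup>2 * \<mu> x + (-2) * (f x * g x * \<mu> x)) summable_on UNIV"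
    by (intro summable_on_add l2_square_summable l2_mult_summable summable_on_cmult_right assms)
  then show ?thesis
    unfolding l2_def by (simp add: power2_eq_square algebra_simps)
qed

lemma mean_nonneg: "(\<And>x. 0 \<le> f x) \<Longrightarrow> 0 \<le> mean \<mu> f"
  unfolding mean_def by (rule infsum_nonneg) (simp add: nonneg)

end

locale probability_weight = positive_weight +
  assumes mass: "total_mass \<mu> = 1"
begin

lemma mean_square_deviation:
  assumes f: "f \<in> l2 \<mu>"
  shows "mean \<mu> (\<lambda>x. (f x - c)\<^sup>2) = Var \<mu> f + (mean \<mu> f - c)\<^sup>2"
proof -
  have "((\<lambda>x. (f x)\<^sup>2 * \<mu> x + (- 2 * c) * (f x * \<mu> x) + c\<^sup>2 * \<mu> x)
          has_sum (mean \<mu> (\<lambda>x. (f x)\<^sup>2) + (- 2 * c) * mean \<mu> f + c\<^sup>2 * total_mass \<mu>)) UNIV"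
    unfolding mean_def total_mass_def
    by (intro has_sum_add has_sum_cmult_right has_sum_infsum l2_summable l2_square_summable
        summable f)
  moreover have "(\<lambda>x. (f x)\<^sup>2 * \<mu> x + (- 2 * c) * (f x * \<mu> x) + c\<^sup>2 * \<mu> x)
      = (\<lambda>x. (f x - c)\<^sup>2 * \<mu> x)"
    by (auto simp: power2_eq_square algebra_simps)
  ultimately have "((\<lambda>x. (f x - c)\<^sup>2 * \<mu> x)
          has_sum (mean \<mu> (\<lambda>x. (f x)\<^sup>2) + (- 2 * c) * mean \<mu> f + c\<^sup>2 * total_mass \<mu>)) UNIV"
    by simp
  then have "mean \<mu> (\<lambda>x. (f x - c)\<^sup>2)
      = mean \<mu> (\<lambda>x. (f x)\<^sup>2) + (- 2 * c) * mean \<mu> f + c\<^sup>2 * total_mass \<mu>"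
    unfolding mean_def[of \<mu> "\<lambda>x. (f x - c)\<^sup>2"] by (rule infsumI)
  moreover have "(mean \<mu> f - c)\<^sup>2 = (mean \<mu> f)\<^sup>2 + (- 2 * c) * mean \<mu> f + c\<^sup>2"
    by (simp add: power2_diff mult_ac)
  ultimately show ?thesis using mass by (simp add: Var_def)
qed

lemma Var_eq: "f \<in> l2 \<mu> \<Longrightarrow> Var \<mu> f = mean \<mu> (\<lambda>x. (f x - mean \<mu> f)\<^sup>2)"
  using mean_square_deviation[of f "mean \<mu> f"] by simp

lemma Var_nonneg: "f \<in> l2 \<mu> \<Longrightarrow> 0 \<le> Var \<mu> f"
  by (simp add: Var_eq mean_nonneg)

lemma Var_pos:
  assumes f: "f \<in> l2 \<mu>" and nc: "\<not> f constant_on UNIV"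
  shows "0 < Var \<mu> f"
proof -
  obtain x where x: "f x \<noteq> mean \<mu> f"
    using nc unfolding constant_on_def by blast
  let ?g = "\<lambda>y. (f y - mean \<mu> f)\<^sup>2 * \<mu> y"
  have "0 < ?g x" using x pos by simp
  also have "?g x = sum ?g {x}" by simp
  also have "\<dots> \<le> infsum ?g UNIV"
    by (rule finite_sum_le_infsum)
       (use l2_square_summable[OF l2_diff[OF f const_in_l2]] nonneg in auto)
  also have "\<dots> = Var \<mu> f" using Var_eq[OF f] by (simp add: mean_def)
  finally show ?thesis .
qed

lemma Var_const: "Var \<mu> (\<lambda>_. c) = 0"
proof -
  have "mean \<mu> (\<lambda>_. a) = a" for a
    using mass unfolding mean_def infsum_cmult_right' total_mass_def by simp
  then show ?thesis by (simp add: Var_def)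
qed

end

context positive_weight
begin

lemma probability_weight_tilde: "probability_weight (tilde \<mu>)"
  by unfold_locales (rule tilde_pos tilde_summable total_mass_tilde)+

lemma l2_mono:
  assumes "positive_weight \<nu>" "\<And>x. \<nu> x \<le> \<mu> x"
  shows "l2 \<mu> \<subseteq> l2 \<nu>"
proof
  fix f assume "f \<in> l2 \<mu>"
  then have "(\<lambda>x. (f x)\<^sup>2 * \<nu> x) summable_on UNIV"
    by (intro summable_on_dominated[OF l2_square_summable])
       (use assms positive_weight.nonneg[OF assms(1)] in \<open>auto intro!: mult_left_mono\<close>)
  then show "f \<in> l2 \<nu>" by (simp add: l2_def)
qed

lemma mass_Var_mono:
  assumes \<nu>: "positive_weight \<nu>" and le: "\<And>x. \<nu> x \<le> \<mu> x" and f: "f \<in> l2 \<mu>"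
  shows "total_mass \<nu> * Var (tilde \<nu>) f \<le> total_mass \<mu> * Var (tilde \<mu>) f"
proof -
  interpret N: positive_weight \<nu> by fact
  interpret N': probability_weight "tilde \<nu>" by (rule N.probability_weight_tilde)
  interpret M': probability_weight "tilde \<mu>" by (rule probability_weight_tilde)
  define c where "c = mean (tilde \<mu>) f"
  have f': "f \<in> l2 \<nu>" using l2_mono[OF \<nu> le] f by auto
  have "total_mass \<nu> * Var (tilde \<nu>) f \<le> total_mass \<nu> * mean (tilde \<nu>) (\<lambda>x. (f x - c)\<^sup>2)"
    using N'.mean_square_deviation[of f c] f' N.l2_tilde N.total_mass_pos by simp
  also have "\<dots> = mean \<nu> (\<lambda>x. (f x - c)\<^sup>2)" by (rule N.mean_tilde)
  also have "\<dots> \<le> mean \<mu> (\<lambda>x. (f x - c)\<^sup>2)"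
    unfolding mean_def
    by (intro infsum_mono l2_square_summable N.l2_square_summable l2_diff N.l2_diff
        const_in_l2 N.const_in_l2 f f' mult_left_mono le) simp
  also have "\<dots> = total_mass \<mu> * mean (tilde \<mu>) (\<lambda>x. (f x - c)\<^sup>2)" by (rule mean_tilde[symmetric])
  also have "\<dots> = total_mass \<mu> * Var (tilde \<mu>) f"
    using M'.Var_eq[of f] f l2_tilde by (simp add: c_def)
  finally show ?thesis .
qed

end

subsection \<open>Markov kernels with an invariant measure\<close>

lemma markov_operator_ge_0: "markov_operator K \<Longrightarrow> 0 \<le> K x y"
  and markov_operator_le_1: "markov_operator K \<Longrightarrow> K x y \<le> 1"
  and markov_operator_has_sum: "markov_operator K \<Longrightarrow> (K x has_sum 1) UNIV"
  by (auto simp: markov_operator_def)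

definition time_reversal :: "('v \<Rightarrow> real) \<Rightarrow> 'v kernel \<Rightarrow> 'v kernel" where
  "time_reversal \<mu> K x y = \<mu> y * K y x / \<mu> x"

locale invariant_weight = positive_weight +
  fixes K :: "'a kernel"
  assumes markov: "markov_operator K" and invariant: "act_meas \<mu> K = \<mu>"
begin

lemmas K_nonneg = markov_operator_ge_0[OF markov]
  and K_le_1 = markov_operator_le_1[OF markov]
  and K_has_sum = markov_operator_has_sum[OF markov]

lemma column_has_sum: "((\<lambda>x. \<mu> x * K x y) has_sum \<mu> y) UNIV"
proof -
  have "(\<lambda>x. \<mu> x * K x y) summable_on UNIV"
    by (rule summable_on_dominated[OF summable])
       (use nonneg K_nonneg K_le_1 in \<open>auto simp: abs_mult intro: mult_left_le\<close>)
  moreover have "(\<Sum>\<^sub>\<infinity>x. \<mu> x * K x y) = \<mu> y"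
    using fun_cong[OF invariant, of y] by (simp add: act_meas_def)
  ultimately show ?thesis by (simp add: has_sum_iff)
qed

lemma joint_summable_target:
  assumes "(\<lambda>y. g y * \<mu> y) summable_on UNIV"
  shows "(\<lambda>(x, y). \<mu> x * K x y * g y) summable_on UNIV \<times> UNIV"
proof -
  have "(\<lambda>(y, x). \<mu> x * K x y * \<bar>g y\<bar>) summable_on UNIV \<times> UNIV"
  proof (rule summable_on_SigmaI)
    show "((\<lambda>x. case (y, x) of (y, x) \<Rightarrow> \<mu> x * K x y * \<bar>g y\<bar>) has_sum (\<mu> y * \<bar>g y\<bar>)) UNIV" for y
      using has_sum_cmult_left[OF column_has_sum[of y], where c = "\<bar>g y\<bar>"] by simp
    show "(\<lambda>y. \<mu> y * \<bar>g y\<bar>) summable_on UNIV"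
      using summable_on_real_abs[OF assms] nonneg by (simp add: abs_mult mult.commute)
  qed (use nonneg K_nonneg in auto)
  then have "(\<lambda>(x, y). \<mu> x * K x y * \<bar>g y\<bar>) summable_on UNIV \<times> UNIV"
    by (subst summable_on_swap) simp
  then show ?thesis
    by (rule summable_on_dominated) (use nonneg K_nonneg in \<open>auto simp: abs_mult\<close>)
qed

lemma joint_summable_source:
  assumes "(\<lambda>x. g x * \<mu> x) summable_on UNIV"
  shows "(\<lambda>(x, y). \<mu> x * K x y * g x) summable_on UNIV \<times> UNIV"
proof -
  have "(\<lambda>(x, y). \<mu> x * K x y * \<bar>g x\<bar>) summable_on UNIV \<times> UNIV"
  proof (rule summable_on_SigmaI)
    show "((\<lambda>y. case (x, y) of (x, y) \<Rightarrow> \<mu> x * K x y * \<bar>g x\<bar>) has_sum (\<mu> x * \<bar>g x\<bar>)) UNIV" for x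
      using has_sum_cmult_right[OF K_has_sum[of x], where c = "\<mu> x * \<bar>g x\<bar>"] by (simp add: mult_ac)
    show "(\<lambda>x. \<mu> x * \<bar>g x\<bar>) summable_on UNIV"
      using summable_on_real_abs[OF assms] nonneg by (simp add: abs_mult mult.commute)
  qed (use nonneg K_nonneg in auto)
  then show ?thesis
    by (rule summable_on_dominated) (use nonneg K_nonneg in \<open>auto simp: abs_mult\<close>)
qed

lemma row_summable:
  assumes "(\<lambda>y. g y * \<mu> y) summable_on UNIV"
  shows "(\<lambda>y. K x y * g y) summable_on UNIV"
proof -
  have "(\<lambda>y. \<mu> x * K x y * g y) summable_on UNIV"
    using summable_on_SigmaD1[OF joint_summable_target[OF assms]] by blast
  then have "(\<lambda>y. \<mu> x * (K x y * g y)) summable_on UNIV" by (simp add: mult.assoc)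
  then show ?thesis using pos[of x] by (subst (asm) summable_on_cmult_right') auto
qed

lemma act_fun_has_sum:
  assumes "(\<lambda>y. g y * \<mu> y) summable_on UNIV"
  shows "((\<lambda>y. K x y * g y) has_sum act_fun K g x) UNIV"
  unfolding act_fun_def by (rule has_sum_infsum[OF row_summable[OF assms]])

lemma act_fun_summable:
  assumes "(\<lambda>y. g y * \<mu> y) summable_on UNIV"
  shows "(\<lambda>x. act_fun K g x * \<mu> x) summable_on UNIV"
proof -
  have "(\<lambda>x. \<Sum>\<^sub>\<infinity>y. \<mu> x * K x y * g y) summable_on UNIV"
    using summable_on_Sigma_banach[OF joint_summable_target[OF assms]] by simp
  moreover have "(\<Sum>\<^sub>\<infinity>y. \<mu> x * K x y * g y) = act_fun K g x * \<mu> x" for x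
    unfolding act_fun_def mult.assoc by (simp add: infsum_cmult_right' mult.commute)
  ultimately show ?thesis by simp
qed

lemma mean_act_fun:
  assumes "(\<lambda>y. g y * \<mu> y) summable_on UNIV"
  shows "mean \<mu> (act_fun K g) = mean \<mu> g"
proof -
  have "mean \<mu> (act_fun K g) = (\<Sum>\<^sub>\<infinity>x. \<Sum>\<^sub>\<infinity>y. \<mu> x * K x y * g y)"
    unfolding mean_def act_fun_def mult.assoc by (simp add: infsum_cmult_right' mult.commute)
  also have "\<dots> = (\<Sum>\<^sub>\<infinity>y. \<Sum>\<^sub>\<infinity>x. \<mu> x * K x y * g y)"
    by (rule infsum_swap_banach[OF joint_summable_target[OF assms]])
  also have "\<dots> = (\<Sum>\<^sub>\<infinity>y. \<mu> y * g y)"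
    by (rule infsum_cong) (rule infsumI, rule has_sum_cmult_left[OF column_has_sum])
  finally show ?thesis by (simp add: mean_def mult.commute)
qed

lemma act_fun_square_le:
  assumes f: "f \<in> l2 \<mu>"
  shows "(act_fun K f x)\<^sup>2 \<le> act_fun K (\<lambda>y. (f y)\<^sup>2) x"
proof -
  define m where "m = act_fun K f x"
  have "((\<lambda>y. K x y * (f y)\<^sup>2 + (- 2 * m) * (K x y * f y) + m\<^sup>2 * K x y)
      has_sum (act_fun K (\<lambda>y. (f y)\<^sup>2) x + (- 2 * m) * act_fun K f x + m\<^sup>2 * 1)) UNIV"
    by (intro has_sum_add has_sum_cmult_right act_fun_has_sum K_has_sum l2_summable
        l2_square_summable f)
  moreover have "0 \<le> K x y * (f y)\<^sup>2 + (- 2 * m) * (K x y * f y) + m\<^sup>2 * K x y" for y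
  proof -
    have "0 \<le> K x y * (f y - m)\<^sup>2" using K_nonneg by simp
    then show ?thesis by (simp add: power2_eq_square algebra_simps)
  qed
  ultimately have "0 \<le> act_fun K (\<lambda>y. (f y)\<^sup>2) x + (- 2 * m) * act_fun K f x + m\<^sup>2 * 1"
    by (rule has_sum_nonneg)
  then show ?thesis by (simp add: m_def power2_eq_square)
qed

lemma act_fun_in_l2:
  assumes f: "f \<in> l2 \<mu>" shows "act_fun K f \<in> l2 \<mu>"
proof -
  have "(\<lambda>x. (act_fun K f x)\<^sup>2 * \<mu> x) summable_on UNIV"
    by (rule summable_on_dominated[OF act_fun_summable[OF l2_square_summable[OF f]]])
       (use act_fun_square_le[OF f] nonneg in \<open>auto intro!: mult_right_mono\<close>)
  then show ?thesis by (simp add: l2_def)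
qed

lemma l2_inner_act_fun_le:
  assumes f: "f \<in> l2 \<mu>"
  shows "l2_inner \<mu> (act_fun K f) (act_fun K f) \<le> l2_inner \<mu> f f"
proof -
  have "l2_inner \<mu> (act_fun K f) (act_fun K f) = mean \<mu> (\<lambda>x. (act_fun K f x)\<^sup>2)"
    by (simp add: l2_inner_def mean_def power2_eq_square)
  also have "\<dots> \<le> mean \<mu> (act_fun K (\<lambda>y. (f y)\<^sup>2))"
    unfolding mean_def
    by (intro infsum_mono act_fun_summable l2_square_summable act_fun_in_l2 f mult_right_mono
        act_fun_square_le nonneg)
  also have "\<dots> = l2_inner \<mu> f f"
    unfolding mean_act_fun[OF l2_square_summable[OF f]]
    by (simp add: l2_inner_def mean_def power2_eq_square)
  finally show ?thesis .
qed

lemma act_fun_kernel_comp: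
  assumes A: "\<And>z. 0 \<le> A x z" "\<And>z. A x z \<le> c * \<mu> z"
    and g: "(\<lambda>y. g y * \<mu> y) summable_on UNIV"
  shows "act_fun (kernel_comp A K) g x = act_fun A (act_fun K g) x"
proof -
  have "(\<lambda>(z, y). c * (\<mu> z * K z y * \<bar>g y\<bar>)) summable_on UNIV \<times> UNIV"
    using summable_on_cmult_right[OF joint_summable_target, of "\<lambda>y. \<bar>g y\<bar>" c]
      summable_on_real_abs[OF g] nonneg by (simp add: abs_mult case_prod_unfold)
  then have S: "(\<lambda>(z, y). A x z * K z y * g y) summable_on UNIV \<times> UNIV"
  proof (rule summable_on_dominated, clarsimp)
    fix z y
    have "A x z * (K z y * \<bar>g y\<bar>) \<le> c * \<mu> z * (K z y * \<bar>g y\<bar>)"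
      by (rule mult_right_mono) (use A K_nonneg in auto)
    then show "\<bar>A x z * K z y * g y\<bar> \<le> c * (\<mu> z * K z y * \<bar>g y\<bar>)"
      using A K_nonneg by (simp add: abs_mult mult_ac)
  qed
  have "act_fun (kernel_comp A K) g x = (\<Sum>\<^sub>\<infinity>y. \<Sum>\<^sub>\<infinity>z. A x z * K z y * g y)"
    unfolding act_fun_def kernel_comp_def by (simp add: infsum_cmult_left')
  also have "\<dots> = (\<Sum>\<^sub>\<infinity>z. \<Sum>\<^sub>\<infinity>y. A x z * K z y * g y)"
    by (rule infsum_swap_banach[OF S, symmetric])
  also have "\<dots> = act_fun A (act_fun K g) x"
    unfolding act_fun_def mult.assoc by (simp add: infsum_cmult_right')
  finally show ?thesis .
qed

lemma invariant_weight_time_reversal: "invariant_weight \<mu> (time_reversal \<mu> K)"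
proof unfold_locales
  have row: "(time_reversal \<mu> K x has_sum 1) UNIV" for x
    using has_sum_cmult_left[OF column_has_sum[of x], where c = "inverse (\<mu> x)"] pos[of x]
    by (simp add: time_reversal_def[abs_def] divide_inverse)
  have nn: "0 \<le> time_reversal \<mu> K x y" for x y
    using nonneg K_nonneg by (simp add: time_reversal_def)
  have "time_reversal \<mu> K x y \<le> 1" for x y
  proof -
    have "sum (time_reversal \<mu> K x) {y} \<le> 1"
      by (rule finite_sum_le_has_sum[OF row]) (use nn in auto)
    then show ?thesis by simp
  qed
  with nn row show "markov_operator (time_reversal \<mu> K)"
    by (simp add: markov_operator_def)
  have "(\<Sum>\<^sub>\<infinity>x. \<mu> x * time_reversal \<mu> K x y) = \<mu> y" for y
  proof -
    have "(\<lambda>x. \<mu> x * time_reversal \<mu> K x y) = (\<lambda>x. \<mu> y * K y x)"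
      using pos by (auto simp: time_reversal_def fun_eq_iff less_imp_neq[symmetric])
    then show ?thesis
      using infsumI[OF has_sum_cmult_right[OF K_has_sum[of y], where c = "\<mu> y"]] by simp
  qed
  then show "act_meas \<mu> (time_reversal \<mu> K) = \<mu>" by (auto simp: act_meas_def)
qed

lemma l2_inner_time_reversal:
  assumes f: "f \<in> l2 \<mu>" and g: "g \<in> l2 \<mu>"
  shows "l2_inner \<mu> (act_fun K f) g = l2_inner \<mu> f (act_fun (time_reversal \<mu> K) g)"
proof -
  have "(\<lambda>(x, y). \<mu> x * K x y * (f y)\<^sup>2 + \<mu> x * K x y * (g x)\<^sup>2) summable_on UNIV \<times> UNIV"
    using summable_on_add[OF joint_summable_target[OF l2_square_summable[OF f]]
        joint_summable_source[OF l2_square_summable[OF g]]]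
    by (simp add: case_prod_unfold)
  then have S: "(\<lambda>(x, y). \<mu> x * K x y * (f y * g x)) summable_on UNIV \<times> UNIV"
  proof (rule summable_on_dominated, clarsimp)
    fix x y
    have "\<mu> x * K x y * \<bar>f y * g x\<bar> \<le> \<mu> x * K x y * ((f y)\<^sup>2 + (g x)\<^sup>2)"
      by (rule mult_left_mono[OF abs_mult_le_sum_squares]) (use nonneg K_nonneg in auto)
    then show "\<bar>\<mu> x * K x y * (f y * g x)\<bar> \<le> \<mu> x * K x y * (f y)\<^sup>2 + \<mu> x * K x y * (g x)\<^sup>2"
      using nonneg K_nonneg by (simp add: abs_mult distrib_left)
  qed
  have "l2_inner \<mu> (act_fun K f) g = (\<Sum>\<^sub>\<infinity>x. \<Sum>\<^sub>\<infinity>y. \<mu> x * K x y * (f y * g x))"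
    unfolding l2_inner_def act_fun_def
    by (simp add: mult_ac flip: infsum_cmult_right')
  also have "\<dots> = (\<Sum>\<^sub>\<infinity>y. \<Sum>\<^sub>\<infinity>x. \<mu> x * K x y * (f y * g x))"
    by (rule infsum_swap_banach[OF S])
  also have "\<dots> = (\<Sum>\<^sub>\<infinity>y. \<Sum>\<^sub>\<infinity>x. f y * \<mu> y * (time_reversal \<mu> K y x * g x))"
    using pos by (simp add: time_reversal_def less_imp_neq[symmetric] mult_ac)
  also have "\<dots> = l2_inner \<mu> f (act_fun (time_reversal \<mu> K) g)"
    unfolding l2_inner_def act_fun_def infsum_cmult_right' by (simp add: mult_ac)
  finally show ?thesis .
qed

lemma is_l2_adjoint_time_reversal: "is_l2_adjoint \<mu> K (time_reversal \<mu> K)"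
  unfolding is_l2_adjoint_def
  using invariant_weight.act_fun_in_l2[OF invariant_weight_time_reversal] l2_inner_time_reversal
  by blast

lemma act_fun_indicator: "act_fun L (indicator {y}) x = L x y"
proof -
  have "((\<lambda>z. L x z * indicator {y} z) has_sum L x y) UNIV"
    by (rule has_sum_finite_neutralI[where B = "{y}"]) auto
  then show ?thesis unfolding act_fun_def by (rule infsumI)
qed

lemma l2_inner_indicator:
  "l2_inner \<mu> f (indicator {y}) = f y * \<mu> y" "l2_inner \<mu> (indicator {y}) f = f y * \<mu> y"
  unfolding l2_inner_def
  by (rule infsumI, rule has_sum_finite_neutralI[where B = "{y}"]; auto)+

lemma l2_adjoint_eq: "l2_adjoint \<mu> K = time_reversal \<mu> K"
  unfolding l2_adjoint_def
proof (rule the_equality[where P = "is_l2_adjoint \<mu> K"])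
  fix L assume "is_l2_adjoint \<mu> K L"
  then have "l2_inner \<mu> (act_fun K (indicator {x})) (indicator {y})
      = l2_inner \<mu> (indicator {x}) (act_fun L (indicator {y}))" for x y
    unfolding is_l2_adjoint_def using indicator_in_l2 by blast
  then have "K y x * \<mu> y = L x y * \<mu> x" for x y
    by (simp add: l2_inner_indicator act_fun_indicator)
  then show "L = time_reversal \<mu> K"
    using pos by (auto simp: time_reversal_def fun_eq_iff field_simps less_imp_neq[symmetric])
qed (rule is_l2_adjoint_time_reversal)

lemma dirichlet_form_reversal_comp:
  assumes f: "f \<in> l2 \<mu>"
  shows "dirichlet_form (kernel_comp (time_reversal \<mu> K) K) \<mu> f
    = l2_inner \<mu> f f - l2_inner \<mu> (act_fun K f) (act_fun K f)"
proof -
  interpret R: invariant_weight \<mu> "time_reversal \<mu> K" by (rule invariant_weight_time_reversal)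
  define g where "g = act_fun (time_reversal \<mu> K) (act_fun K f)"
  have g: "g \<in> l2 \<mu>" unfolding g_def by (intro R.act_fun_in_l2 act_fun_in_l2 f)
  have "act_fun (kernel_comp (time_reversal \<mu> K) K) f x = g x" for x
    unfolding g_def
  proof (rule act_fun_kernel_comp[where c = "inverse (\<mu> x)"])
    show "time_reversal \<mu> K x z \<le> inverse (\<mu> x) * \<mu> z" for z
      unfolding time_reversal_def
      using nonneg pos[of x] K_nonneg K_le_1[of z x]
      by (simp add: field_simps mult_left_le)
  qed (use R.K_nonneg l2_summable[OF f] in auto)
  then have "dirichlet_form (kernel_comp (time_reversal \<mu> K) K) \<mu> f
      = (\<Sum>\<^sub>\<infinity>x. f x * f x * \<mu> x + (-1) * (f x * g x * \<mu> x))"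
    by (simp add: dirichlet_form_def l2_inner_def algebra_simps)
  also have "\<dots> = l2_inner \<mu> f f + (-1) * l2_inner \<mu> f g"
    unfolding l2_inner_def
    by (intro infsumI has_sum_add has_sum_cmult_right has_sum_infsum l2_mult_summable f g)
  also have "l2_inner \<mu> f g = l2_inner \<mu> (act_fun K f) (act_fun K f)"
    unfolding g_def by (rule l2_inner_time_reversal[symmetric]) (intro act_fun_in_l2 f)+
  finally show ?thesis by simp
qed

lemma invariant_weight_tilde: "invariant_weight (tilde \<mu>) K"
proof -
  interpret T: probability_weight "tilde \<mu>" by (rule probability_weight_tilde)
  have "(\<Sum>\<^sub>\<infinity>x. tilde \<mu> x * K x y) = tilde \<mu> y" for y
    using infsumI[OF has_sum_cmult_left[OF column_has_sum[of y], where c = "inverse (total_mass \<mu>)"]]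
    by (simp add: tilde_def divide_inverse mult_ac)
  then show ?thesis
    by unfold_locales (auto simp: act_meas_def markov)
qed

lemma time_reversal_tilde: "time_reversal (tilde \<mu>) K = time_reversal \<mu> K"
  using total_mass_pos by (auto simp: time_reversal_def tilde_def fun_eq_iff)

theorem Var_act_fun_le:
  assumes f: "f \<in> l2 \<mu>"
  shows "Var (tilde \<mu>) (act_fun K f)
    \<le> second_eigenvalue (kernel_comp (l2_adjoint \<mu> K) K) \<mu> * Var (tilde \<mu>) f"
proof -
  interpret T: invariant_weight "tilde \<mu>" K by (rule invariant_weight_tilde)
  interpret P: probability_weight "tilde \<mu>" by (rule probability_weight_tilde)
  define Q where "Q = kernel_comp (l2_adjoint \<mu> K) K"
  define S where "S = {dirichlet_form Q (tilde \<mu>) f / Var (tilde \<mu>) f | f.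
                f \<in> l2 (tilde \<mu>) \<and> \<not> f constant_on UNIV}"
  have f': "f \<in> l2 (tilde \<mu>)" using f by (simp add: l2_tilde)
  have D: "dirichlet_form Q (tilde \<mu>) h
      = l2_inner (tilde \<mu>) h h - l2_inner (tilde \<mu>) (act_fun K h) (act_fun K h)"
    if "h \<in> l2 (tilde \<mu>)" for h
    using T.dirichlet_form_reversal_comp[OF that]
    by (simp add: Q_def l2_adjoint_eq time_reversal_tilde)
  show ?thesis
  proof (cases "f constant_on UNIV")
    case True
    then obtain c where "f = (\<lambda>_. c)" unfolding constant_on_def by auto
    moreover have "act_fun K (\<lambda>_. c) = (\<lambda>_. c)"
      unfolding act_fun_def using infsumI[OF has_sum_cmult_left[OF K_has_sum, where c = c]] by auto
    ultimately show ?thesis by (simp add: P.Var_const)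
  next
    case False
    have V: "0 < Var (tilde \<mu>) f" by (rule P.Var_pos[OF f' False])
    have "bdd_below S"
    proof (rule bdd_belowI[where m = 0])
      fix r assume "r \<in> S"
      then obtain h where h: "h \<in> l2 (tilde \<mu>)"
        and r: "r = dirichlet_form Q (tilde \<mu>) h / Var (tilde \<mu>) h"
        unfolding S_def by blast
      show "0 \<le> r"
        unfolding r D[OF h] using T.l2_inner_act_fun_le[OF h] P.Var_nonneg[OF h] by simp
    qed
    moreover have "dirichlet_form Q (tilde \<mu>) f / Var (tilde \<mu>) f \<in> S"
      using f' False unfolding S_def by blast
    ultimately have "Inf S \<le> dirichlet_form Q (tilde \<mu>) f / Var (tilde \<mu>) f"
      by (rule cInf_lower[rotated])
    also have "dirichlet_form Q (tilde \<mu>) f = Var (tilde \<mu>) f - Var (tilde \<mu>) (act_fun K f)"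
      unfolding D[OF f'] Var_def T.mean_act_fun[OF T.l2_summable[OF f']]
      by (simp add: l2_inner_def mean_def power2_eq_square)
    finally have "Inf S * Var (tilde \<mu>) f \<le> Var (tilde \<mu>) f - Var (tilde \<mu>) (act_fun K f)"
      using V by (simp add: pos_le_divide_eq)
    then show ?thesis
      unfolding second_eigenvalue_def Q_def[symmetric] S_def[symmetric]
      by (simp add: algebra_simps)
  qed
qed

lemma second_eigenvalue_nonneg:
  assumes "\<exists>x y :: 'a. x \<noteq> y"
  shows "0 \<le> second_eigenvalue (kernel_comp (l2_adjoint \<mu> K) K) \<mu>"
proof -
  interpret P: probability_weight "tilde \<mu>" by (rule probability_weight_tilde)
  obtain x y :: 'a where xy: "x \<noteq> y" using assms by blast
  let ?f = "indicator {x} :: 'a \<Rightarrow> real"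
  have "?f x \<noteq> ?f y" using xy by simp
  then have "\<not> ?f constant_on UNIV" unfolding constant_on_def by (metis UNIV_I)
  then have V: "0 < Var (tilde \<mu>) ?f" by (rule P.Var_pos[OF P.indicator_in_l2])
  have "0 \<le> Var (tilde \<mu>) (act_fun K ?f)"
    by (rule P.Var_nonneg) (simp add: l2_tilde act_fun_in_l2 indicator_in_l2)
  also note Var_act_fun_le[OF indicator_in_l2]
  finally show ?thesis using V by (simp add: zero_le_mult_iff)
qed

end

subsection \<open>Finite non-decreasing environments\<close>

locale nondecreasing_env =
  fixes K :: "nat \<Rightarrow> 'v \<Rightarrow> 'v \<Rightarrow> real" and \<pi> :: "nat \<Rightarrow> 'v \<Rightarrow> real"
  assumes env: "finite_nondecreasing_env K \<pi>" and init: "\<pi> 0 = \<pi> 1"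
begin

lemma weight: "positive_weight (\<pi> t)"
proof -
  have "positive_weight (\<pi> t)" if "t \<ge> 1" for t
    using env that by unfold_locales (auto simp: finite_nondecreasing_env_def)
  then show ?thesis using init by (cases t) auto
qed

lemma step: "invariant_weight (\<pi> (Suc t)) (K (Suc t))"
proof -
  interpret positive_weight "\<pi> (Suc t)" by (rule weight)
  show ?thesis
    using env by unfold_locales (auto simp: finite_nondecreasing_env_def)
qed

lemma mono_Suc: "\<pi> t x \<le> \<pi> (Suc t) x"
  using env init by (cases t) (auto simp: finite_nondecreasing_env_def)

lemma iter_kernel_nonneg: "0 \<le> iter_kernel K t x y"
proof (induction t arbitrary: y)
  case 0
  then show ?case by (simp add: kernel_id_def)
next
  case (Suc t)
  interpret invariant_weight "\<pi> (Suc t)" "K (Suc t)" by (rule step)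
  show ?case using Suc K_nonneg by (simp add: kernel_comp_def infsum_nonneg)
qed

text \<open>
  Subinvariance \<open>\<pi>\<^sub>1 K\<^sub>1 \<cdots> K\<^sub>t \<le> \<pi>\<^sub>t\<close>, in the pointwise form that makes every function in
  \<open>\<ell>\<^sup>2(\<pi>\<^sub>t)\<close> summable against the rows of \<open>K\<^sub>1 \<cdots> K\<^sub>t\<close>.
\<close>

lemma iter_kernel_le: "iter_kernel K t x y \<le> inverse (\<pi> 1 x) * \<pi> t y"
proof (induction t arbitrary: y)
  case 0
  have "0 < \<pi> 1 x" "0 < \<pi> 1 y" by (rule positive_weight.pos[OF weight])+
  then show ?case using init by (auto simp: kernel_id_def)
next
  case (Suc t)
  interpret invariant_weight "\<pi> (Suc t)" "K (Suc t)" by (rule step)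
  let ?c = "inverse (\<pi> 1 x)"
  have c: "0 \<le> ?c" using positive_weight.nonneg[OF weight] by simp
  have S: "((\<lambda>z. ?c * (\<pi> (Suc t) z * K (Suc t) z y)) has_sum ?c * \<pi> (Suc t) y) UNIV"
    by (rule has_sum_cmult_right[OF column_has_sum])
  have le: "iter_kernel K t x z * K (Suc t) z y \<le> ?c * (\<pi> (Suc t) z * K (Suc t) z y)" for z
  proof -
    have "iter_kernel K t x z \<le> ?c * \<pi> (Suc t) z"
      using Suc[of z] mult_left_mono[OF mono_Suc c, of t z] by linarith
    from mult_right_mono[OF this K_nonneg] show ?thesis by (simp add: mult_ac)
  qed
  have "(\<lambda>z. iter_kernel K t x z * K (Suc t) z y) summable_on UNIV"
    by (rule summable_on_dominated[OF has_sum_imp_summable[OF S]])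
       (use le K_nonneg iter_kernel_nonneg in \<open>auto simp: abs_mult\<close>)
  then have "iter_kernel K (Suc t) x y \<le> (\<Sum>\<^sub>\<infinity>z. ?c * (\<pi> (Suc t) z * K (Suc t) z y))"
    unfolding iter_kernel.simps kernel_comp_def
    by (rule infsum_mono[OF _ has_sum_imp_summable[OF S] le])
  also have "\<dots> = ?c * \<pi> (Suc t) y" by (rule infsumI[OF S])
  finally show ?case .
qed

lemma act_fun_iter_kernel_Suc:
  assumes f: "f \<in> l2 (\<pi> (Suc t))"
  shows "act_fun (iter_kernel K (Suc t)) f = act_fun (iter_kernel K t) (act_fun (K (Suc t)) f)"
proof
  fix x
  interpret invariant_weight "\<pi> (Suc t)" "K (Suc t)" by (rule step)
  have c: "0 \<le> inverse (\<pi> 1 x)" using positive_weight.nonneg[OF weight] by simp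
  show "act_fun (iter_kernel K (Suc t)) f x
      = act_fun (iter_kernel K t) (act_fun (K (Suc t)) f) x"
    unfolding iter_kernel.simps
  proof (rule act_fun_kernel_comp)
    show "iter_kernel K t x z \<le> inverse (\<pi> 1 x) * \<pi> (Suc t) z" for z
      using iter_kernel_le[of t x z] mult_left_mono[OF mono_Suc c, of t z] by linarith
  qed (use iter_kernel_nonneg l2_summable[OF f] in auto)
qed

lemma act_fun_step_in_l2:
  assumes "f \<in> l2 (\<pi> (Suc t))" shows "act_fun (K (Suc t)) f \<in> l2 (\<pi> t)"
  using invariant_weight.act_fun_in_l2[OF step assms]
    positive_weight.l2_mono[OF weight weight mono_Suc] by blast

lemma act_fun_iter_kernel_in_l2:
  "f \<in> l2 (\<pi> t) \<Longrightarrow> act_fun (iter_kernel K t) f \<in> l2 (\<pi> 1)"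
proof (induction t arbitrary: f)
  case 0
  then show ?case using init by (simp add: act_fun_kernel_id)
next
  case (Suc t)
  show ?case
    unfolding act_fun_iter_kernel_Suc[OF Suc.prems]
    by (rule Suc.IH[OF act_fun_step_in_l2[OF Suc.prems]])
qed

lemma mass_Var_iter_kernel_le:
  assumes lam: "\<And>t. lam (Suc t)
      = second_eigenvalue (kernel_comp (l2_adjoint (\<pi> (Suc t)) (K (Suc t))) (K (Suc t))) (\<pi> (Suc t))"
    and lam_nonneg: "\<And>t. 0 \<le> lam (Suc t)"
  shows "f \<in> l2 (\<pi> t) \<Longrightarrow> total_mass (\<pi> 1) * Var (tilde (\<pi> 1)) (act_fun (iter_kernel K t) f)
    \<le> total_mass (\<pi> t) * Var (tilde (\<pi> t)) f * (\<Prod>s=1..t. lam s)"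
proof (induction t arbitrary: f)
  case 0
  then show ?case using init by (simp add: act_fun_kernel_id)
next
  case (Suc t)
  interpret invariant_weight "\<pi> (Suc t)" "K (Suc t)" by (rule step)
  define g where "g = act_fun (K (Suc t)) f"
  have P: "0 \<le> (\<Prod>s=1..t. lam s)"
    using lam_nonneg by (intro prod_nonneg) (metis Suc_pred' atLeastAtMost_iff less_le_trans zero_less_one)
  have "total_mass (\<pi> t) * Var (tilde (\<pi> t)) g \<le> total_mass (\<pi> (Suc t)) * Var (tilde (\<pi> (Suc t))) g"
    by (rule mass_Var_mono[OF weight mono_Suc]) (simp add: g_def act_fun_in_l2 Suc.prems)
  also have "\<dots> \<le> total_mass (\<pi> (Suc t)) * (lam (Suc t) * Var (tilde (\<pi> (Suc t))) f)"
    unfolding g_def lam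
    by (rule mult_left_mono[OF Var_act_fun_le[OF Suc.prems]]) (use total_mass_pos in simp)
  finally have step_le: "total_mass (\<pi> t) * Var (tilde (\<pi> t)) g
    \<le> total_mass (\<pi> (Suc t)) * (lam (Suc t) * Var (tilde (\<pi> (Suc t))) f)" .
  have "total_mass (\<pi> 1) * Var (tilde (\<pi> 1)) (act_fun (iter_kernel K (Suc t)) f)
      \<le> total_mass (\<pi> t) * Var (tilde (\<pi> t)) g * (\<Prod>s=1..t. lam s)"
    unfolding act_fun_iter_kernel_Suc[OF Suc.prems] g_def
    by (rule Suc.IH[OF act_fun_step_in_l2[OF Suc.prems]])
  also note mult_right_mono[OF step_le P]
  finally show ?case by (simp add: mult_ac)
qed

end

theorem theorem3p6:
  fixes K :: "nat \<Rightarrow> 'v::countable \<Rightarrow> 'v \<Rightarrow> real"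
    and \<pi> :: "nat \<Rightarrow> 'v \<Rightarrow> real"
    and lam :: "nat \<Rightarrow> real"
  assumes two: "\<exists>x y :: 'v. x \<noteq> y"
    and env: "finite_nondecreasing_env K \<pi>"
    and pi0: "\<pi> 0 = \<pi> 1"
    and lam: "\<And>t. t \<ge> 1 \<Longrightarrow>
      lam t = second_eigenvalue (kernel_comp (l2_adjoint (\<pi> t) (K t)) (K t)) (\<pi> t)"
  shows "(\<forall>t. \<forall>f\<in>l2 (\<pi> t).
            Var (tilde (\<pi> 1)) (act_fun (iter_kernel K t) f)
              \<le> total_mass (\<pi> t) / total_mass (\<pi> 1) * Var (tilde (\<pi> t)) f * (\<Prod>s=1..t. lam s))
       \<and> (\<forall>t. l2_op_norm (tilde (\<pi> t)) (tilde (\<pi> 1))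
              (\<lambda>f x. act_fun (iter_kernel K t) f x
                       - mean (tilde (\<pi> 1)) (act_fun (iter_kernel K t) f))
            \<le> ennreal (sqrt (total_mass (\<pi> t) / total_mass (\<pi> 1) * (\<Prod>s=1..t. lam s))))"
proof -
  interpret nondecreasing_env K \<pi> by unfold_locales (fact env pi0)+
  interpret \<pi>1: positive_weight "\<pi> 1" by (rule weight)
  interpret \<tau>1: probability_weight "tilde (\<pi> 1)" by (rule \<pi>1.probability_weight_tilde)
  have lam_nonneg: "0 \<le> lam (Suc t)" for t
    using invariant_weight.second_eigenvalue_nonneg[OF step two, of t] lam[of "Suc t"] by simp
  have Var_le: "Var (tilde (\<pi> 1)) (act_fun (iter_kernel K t) f)
      \<le> total_mass (\<pi> t) / total_mass (\<pi> 1) * Var (tilde (\<pi> t)) f * (\<Prod>s=1..t. lam s)"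
    if "f \<in> l2 (\<pi> t)" for t f
    using mass_Var_iter_kernel_le[of lam, OF _ lam_nonneg that] lam \<pi>1.total_mass_pos
    by (simp add: field_simps)
  have "l2_norm (tilde (\<pi> 1)) (\<lambda>x. act_fun (iter_kernel K t) f x
          - mean (tilde (\<pi> 1)) (act_fun (iter_kernel K t) f))
      \<le> ennreal (sqrt (total_mass (\<pi> t) / total_mass (\<pi> 1) * (\<Prod>s=1..t. lam s)))"
    if "l2_norm (tilde (\<pi> t)) f \<le> 1" for t f
  proof -
    interpret \<pi>t: positive_weight "\<pi> t" by (rule weight)
    let ?C = "total_mass (\<pi> t) / total_mass (\<pi> 1)" and ?P = "\<Prod>s=1..t. lam s"
    let ?g = "act_fun (iter_kernel K t) f"
    have CP: "0 \<le> ?C * ?P"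
      using lam_nonneg \<pi>1.total_mass_pos \<pi>t.total_mass_pos
      by (intro mult_nonneg_nonneg prod_nonneg)
         (auto, metis Suc_pred' less_le_trans zero_less_one One_nat_def)
    have f: "f \<in> l2 (tilde (\<pi> t))" and "l2_inner (tilde (\<pi> t)) f f \<le> 1"
      using that by (auto simp: l2_norm_def top_unique split: if_splits)
    then have "mean (tilde (\<pi> t)) (\<lambda>x. (f x)\<^sup>2) \<le> 1"
      by (simp add: l2_inner_def mean_def power2_eq_square)
    then have "Var (tilde (\<pi> t)) f \<le> 1"
      unfolding Var_def using zero_le_power2[of "mean (tilde (\<pi> t)) f"] by linarith
    then have "?C * ?P * Var (tilde (\<pi> t)) f \<le> ?C * ?P"
      using CP by (rule mult_left_le)
    moreover have fl2: "f \<in> l2 (\<pi> t)" using f \<pi>t.l2_tilde by simp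
    ultimately have V: "Var (tilde (\<pi> 1)) ?g \<le> ?C * ?P"
      using Var_le[of f t] by (simp add: mult_ac)
    have g: "?g \<in> l2 (tilde (\<pi> 1))"
      using act_fun_iter_kernel_in_l2[OF fl2] \<pi>1.l2_tilde by simp
    have "l2_norm (tilde (\<pi> 1)) (\<lambda>x. ?g x - mean (tilde (\<pi> 1)) ?g)
        = ennreal (sqrt (Var (tilde (\<pi> 1)) ?g))"
      unfolding \<tau>1.Var_eq[OF g] l2_norm_def
      using \<tau>1.l2_diff[OF g \<tau>1.const_in_l2]
      by (simp add: l2_inner_def mean_def power2_eq_square)
    then show ?thesis using V by (simp add: ennreal_leI)
  qed
  then show ?thesis
    using Var_le unfolding l2_op_norm_def by (auto intro!: SUP_least)
qed

end
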